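(* Let $n\geq 1$. For every $x\in\mathbb{A}_n$ the series $\exp(x)=\sum_{m=0}^{\infty}\frac{x^m}{m!}$ converges. Moreover, if $x=re_0+a$ with $r\in\mathbb{R}$ and $a\in\mathrm{Im}(\mathbb{A}_n)$, then $$\exp(x)=e^r\exp(a),$$ where $e^r$ is the usual real exponential.
   Context: The Cayley-Dickson algebras $\mathbb{A}_n=\mathbb{R}^{2^n}$ are defined by $\mathbb{A}_0=\mathbb{R}$ with $\overline{x}=x$, and $\mathbb{A}_{n+1}=\mathbb{A}_n\times\mathbb{A}_n$ with product $(a,b)(x,y)=(ax-\overline{y}b,\;ya+b\overline{x})$ and conjugation $\overline{(x_1,x_2)}=(\overline{x_1},-x_2)$. The first canonical basis vector $e_0$ is the unit. $\mathrm{Im}(\mathbb{A}_n)$ is the span of the remaining canonical basis vectors $e_1,\dots,e_{2^n-1}$, so $\mathbb{A}_n=\mathbb{R}e_0\oplus\mathrm{Im}(\mathbb{A}_n)$. Convergence is with respect to the Euclidean norm of $\mathbb{R}^{2^n}$. Powers are $x^0=e_0$, $x^{m+1}=x^m x$ (the algebras are power-associative). *)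

theory Defs
  imports "HOL-Analysis.Analysis" "HOL-Library.Function_Algebras"
begin

text \<open>
  The space \<open>\<real>\<^sup>N\<close> with \<open>N = 2 ^ n\<close> is modelled by the functions \<open>nat \<Rightarrow> real\<close> that vanish
  from index \<open>2 ^ n\<close> on; the entry at \<open>i < 2 ^ n\<close> is the coefficient of the
  canonical basis vector \<open>e\<^sub>i\<close>. Addition is pointwise (from \<open>Function_Algebras\<close>); the pointwise
  product and the constant function \<open>1\<close> of that theory are not the algebra product and unit.
\<close>

instantiation "fun" :: (type, real_vector) real_vector
begin

definition scaleR_fun :: "real \<Rightarrow> ('a \<Rightarrow> 'b) \<Rightarrow> 'a \<Rightarrow> 'b"
  where "scaleR_fun r f = (\<lambda>i. r *\<^sub>R f i)"

instance
  by standard (simp_all add: scaleR_fun_def fun_eq_iff scaleR_add_right scaleR_add_left)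

end

definition cd_carrier :: "nat \<Rightarrow> (nat \<Rightarrow> real) set"
  where "cd_carrier n = {x. \<forall>i\<ge>2 ^ n. x i = 0}"

definition cd_e :: "nat \<Rightarrow> nat \<Rightarrow> real"
  where "cd_e i = (\<lambda>j. if j = i then 1 else 0)"

text \<open>
  The identification of level \<open>n + 1\<close> with pairs of elements of level \<open>n\<close> is concatenation of
  coordinates: the first component occupies the indices below \<open>2 ^ n\<close>, the second one the
  indices from \<open>2 ^ n\<close> to \<open>2 ^ (n + 1) - 1\<close>.
\<close>

definition cd_pair :: "nat \<Rightarrow> (nat \<Rightarrow> real) \<Rightarrow> (nat \<Rightarrow> real) \<Rightarrow> nat \<Rightarrow> real"
  where "cd_pair n a b =
    (\<lambda>i. if i < 2 ^ n then a i else if i < 2 ^ Suc n then b (i - 2 ^ n) else 0)"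

definition cd_fst :: "nat \<Rightarrow> (nat \<Rightarrow> real) \<Rightarrow> nat \<Rightarrow> real"
  where "cd_fst n u = (\<lambda>i. if i < 2 ^ n then u i else 0)"

definition cd_snd :: "nat \<Rightarrow> (nat \<Rightarrow> real) \<Rightarrow> nat \<Rightarrow> real"
  where "cd_snd n u = (\<lambda>i. if i < 2 ^ n then u (2 ^ n + i) else 0)"

lemma cd_pair_in_carrier: "cd_pair n a b \<in> cd_carrier (Suc n)"
  by (simp add: cd_pair_def cd_carrier_def)

lemma cd_fst_pair: "a \<in> cd_carrier n \<Longrightarrow> cd_fst n (cd_pair n a b) = a"
  by (auto simp: cd_fst_def cd_pair_def cd_carrier_def fun_eq_iff)

lemma cd_snd_pair: "b \<in> cd_carrier n \<Longrightarrow> cd_snd n (cd_pair n a b) = b"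
  by (auto simp: cd_snd_def cd_pair_def cd_carrier_def fun_eq_iff)

lemma cd_pair_fst_snd: "u \<in> cd_carrier (Suc n) \<Longrightarrow> cd_pair n (cd_fst n u) (cd_snd n u) = u"
  by (auto simp: cd_fst_def cd_snd_def cd_pair_def cd_carrier_def fun_eq_iff)

primrec cd_conj :: "nat \<Rightarrow> (nat \<Rightarrow> real) \<Rightarrow> nat \<Rightarrow> real" where
  "cd_conj 0 x = x"
| "cd_conj (Suc n) x = cd_pair n (cd_conj n (cd_fst n x)) (- cd_snd n x)"

primrec cd_mult :: "nat \<Rightarrow> (nat \<Rightarrow> real) \<Rightarrow> (nat \<Rightarrow> real) \<Rightarrow> nat \<Rightarrow> real" where
  "cd_mult 0 u v = (u 0 * v 0) *\<^sub>R cd_e 0"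
| "cd_mult (Suc n) u v =
    (let a = cd_fst n u; b = cd_snd n u; x = cd_fst n v; y = cd_snd n v
     in cd_pair n (cd_mult n a x - cd_mult n (cd_conj n y) b)
                  (cd_mult n y a + cd_mult n b (cd_conj n x)))"

primrec cd_power :: "nat \<Rightarrow> (nat \<Rightarrow> real) \<Rightarrow> nat \<Rightarrow> nat \<Rightarrow> real" where
  "cd_power n x 0 = cd_e 0"
| "cd_power n x (Suc m) = cd_mult n (cd_power n x m) x"

definition cd_Im :: "nat \<Rightarrow> (nat \<Rightarrow> real) set"
  where "cd_Im n = span (cd_e ` {1..<2 ^ n})"

definition cd_norm :: "nat \<Rightarrow> (nat \<Rightarrow> real) \<Rightarrow> real"
  where "cd_norm n x = L2_set x {..<2 ^ n}"

definition cd_sums :: "nat \<Rightarrow> (nat \<Rightarrow> nat \<Rightarrow> real) \<Rightarrow> (nat \<Rightarrow> real) \<Rightarrow> bool"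
  where "cd_sums n f s \<longleftrightarrow>
    s \<in> cd_carrier n \<and> (\<lambda>N. cd_norm n ((\<Sum>m<N. f m) - s)) \<longlonglongrightarrow> 0"

definition cd_summable :: "nat \<Rightarrow> (nat \<Rightarrow> nat \<Rightarrow> real) \<Rightarrow> bool"
  where "cd_summable n f \<longleftrightarrow> (\<exists>s. cd_sums n f s)"

definition cd_suminf :: "nat \<Rightarrow> (nat \<Rightarrow> nat \<Rightarrow> real) \<Rightarrow> nat \<Rightarrow> real"
  where "cd_suminf n f = (THE s. cd_sums n f s)"

definition cd_exp_term :: "nat \<Rightarrow> (nat \<Rightarrow> real) \<Rightarrow> nat \<Rightarrow> nat \<Rightarrow> real"
  where "cd_exp_term n x m = cd_power n x m /\<^sub>R fact m"

definition cd_exp :: "nat \<Rightarrow> (nat \<Rightarrow> real) \<Rightarrow> nat \<Rightarrow> real"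
  where "cd_exp n x = cd_suminf n (cd_exp_term n x)"

lemma cd_sums_unique:
  assumes "cd_sums n f s" "cd_sums n f t"
  shows "s = t"
proof
  fix i
  have lim: "(\<lambda>N. (\<Sum>m<N. f m) i) \<longlonglongrightarrow> u i" if u: "cd_sums n f u" and i: "i < 2 ^ n" for u
  proof -
    have "\<bar>((\<Sum>m<N. f m) - u) i\<bar> \<le> cd_norm n ((\<Sum>m<N. f m) - u)" for N
      using member_le_L2_set[of "{..<2 ^ n}" i "\<lambda>i. \<bar>((\<Sum>m<N. f m) - u) i\<bar>"] i
      by (simp add: cd_norm_def L2_set_def)
    then have "\<forall>\<^sub>F N in sequentially.
        norm ((\<Sum>m<N. f m) i - u i) \<le> cd_norm n ((\<Sum>m<N. f m) - u)"
      by (intro always_eventually allI) simp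
    moreover have "(\<lambda>N. cd_norm n ((\<Sum>m<N. f m) - u)) \<longlonglongrightarrow> 0"
      using u by (simp add: cd_sums_def)
    ultimately have "(\<lambda>N. (\<Sum>m<N. f m) i - u i) \<longlonglongrightarrow> 0"
      by (rule Lim_null_comparison)
    then show ?thesis
      by (simp add: LIM_zero_iff)
  qed
  show "s i = t i"
  proof (cases "i < 2 ^ n")
    case True
    then show ?thesis
      using lim[OF assms(1)] lim[OF assms(2)] LIMSEQ_unique by blast
  next
    case False
    then show ?thesis
      using assms by (simp add: cd_sums_def cd_carrier_def)
  qed
qed

lemma cd_sums_suminf: "cd_summable n f \<Longrightarrow> cd_sums n f (cd_suminf n f)"
  unfolding cd_summable_def cd_suminf_def by (metis cd_sums_unique theI)

end

theory Submission
  imports Defs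
begin

text \<open>
  Every \<open>x\<close> satisfies the quadratic equation \<open>x x = 2 x\<^sub>0 x - \<bar>x\<bar>\<^sup>2 e\<^sub>0\<close>, so an imaginary
  \<open>a\<close> with \<open>\<theta> = \<bar>a\<bar>\<close> satisfies \<open>a a = - \<theta>\<^sup>2 e\<^sub>0\<close>. Hence, for \<open>a \<noteq> 0\<close>, the span of
  \<open>e\<^sub>0\<close> and \<open>a\<close> is a copy of the complex numbers in which \<open>r e\<^sub>0 + a\<close> plays the role of \<open>z = r + i \<theta>\<close>: its \<open>m\<close>-th power is
  \<open>Re (z\<^sup>m) e\<^sub>0 + (Im (z\<^sup>m) / \<theta>) a\<close>. The exponential series is therefore the image of the
  complex one, and the claim is the complex identity \<open>exp (r + i \<theta>) = e\<^sup>r exp (i \<theta>)\<close>.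
\<close>

section \<open>Bilinearity of the product\<close>

lemmas cd_fun_simps = fun_eq_iff scaleR_fun_def plus_fun_def fun_diff_def fun_Compl_def zero_fun_def

lemma cd_fst_linear:
  "cd_fst n (u + v) = cd_fst n u + cd_fst n v"
  "cd_fst n (c *\<^sub>R u) = c *\<^sub>R cd_fst n u"
  by (auto simp: cd_fst_def cd_fun_simps)

lemma cd_snd_linear:
  "cd_snd n (u + v) = cd_snd n u + cd_snd n v"
  "cd_snd n (c *\<^sub>R u) = c *\<^sub>R cd_snd n u"
  by (auto simp: cd_snd_def cd_fun_simps)

lemma cd_pair_add: "cd_pair n a b + cd_pair n c d = cd_pair n (a + c) (b + d)"
  by (auto simp: cd_pair_def cd_fun_simps)

lemma cd_pair_scaleR: "c *\<^sub>R cd_pair n a b = cd_pair n (c *\<^sub>R a) (c *\<^sub>R b)"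
  by (auto simp: cd_pair_def cd_fun_simps)

lemma cd_pair_diff: "cd_pair n a b - cd_pair n c d = cd_pair n (a - c) (b - d)"
  by (auto simp: cd_pair_def cd_fun_simps)

lemma cd_conj_linear:
  "cd_conj n (u + v) = cd_conj n u + cd_conj n v"
  "cd_conj n (c *\<^sub>R u) = c *\<^sub>R cd_conj n u"
  by (induction n arbitrary: u v)
    (simp_all add: cd_fst_linear cd_snd_linear cd_pair_add cd_pair_scaleR)

text \<open>Both laws go through one induction: the product at level \<open>Suc n\<close> places
  components of either factor on both sides of products at level \<open>n\<close>, so each law calls
  on both inductive hypotheses.\<close>

lemma cd_mult_add:
  "cd_mult n (u + v) w = cd_mult n u w + cd_mult n v w"
  "cd_mult n w (u + v) = cd_mult n w u + cd_mult n w v"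
proof (induction n arbitrary: u v w)
  case 0
  {
    case 1
    show ?case by (simp add: cd_fun_simps algebra_simps)
  next
    case 2
    show ?case by (simp add: cd_fun_simps algebra_simps)
  }
next
  case (Suc n)
  {
    case 1
    show ?case
      unfolding cd_mult.simps Let_def cd_fst_linear cd_snd_linear cd_conj_linear cd_pair_add Suc.IH
      by (simp add: algebra_simps)
  next
    case 2
    show ?case
      unfolding cd_mult.simps Let_def cd_fst_linear cd_snd_linear cd_conj_linear cd_pair_add Suc.IH
      by (simp add: algebra_simps)
  }
qed

lemma cd_mult_scaleR:
  "cd_mult n (c *\<^sub>R u) v = c *\<^sub>R cd_mult n u v"
  "cd_mult n u (c *\<^sub>R v) = c *\<^sub>R cd_mult n u v"
proof (induction n arbitrary: u v)
  case 0
  {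
    case 1
    show ?case by (simp add: cd_fun_simps)
  next
    case 2
    show ?case by (simp add: cd_fun_simps)
  }
next
  case (Suc n)
  {
    case 1
    show ?case
      by (simp add: Let_def cd_fst_linear cd_snd_linear cd_conj_linear cd_pair_scaleR Suc.IH
          scaleR_add_right scaleR_diff_right)
  next
    case 2
    show ?case
      by (simp add: Let_def cd_fst_linear cd_snd_linear cd_conj_linear cd_pair_scaleR Suc.IH
          scaleR_add_right scaleR_diff_right)
  }
qed

lemma cd_mult_zero [simp]: "cd_mult n 0 u = 0" "cd_mult n u 0 = 0"
  using cd_mult_scaleR(1)[of n 0 0 u] cd_mult_scaleR(2)[of n u 0 0] by simp_all

lemma cd_mult_diff_left: "cd_mult n (u - v) w = cd_mult n u w - cd_mult n v w"
  using cd_mult_add(1)[of n "u - v" v w] by (simp add: algebra_simps)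

lemma cd_mult_diff_right: "cd_mult n w (u - v) = cd_mult n w u - cd_mult n w v"
  using cd_mult_add(2)[of n w "u - v" v] by (simp add: algebra_simps)

section \<open>Conjugation, unit and the quadratic equation\<close>

lemma cd_fst_in_carrier [simp]: "cd_fst n u \<in> cd_carrier n"
  by (simp add: cd_fst_def cd_carrier_def)

lemma cd_snd_in_carrier [simp]: "cd_snd n u \<in> cd_carrier n"
  by (simp add: cd_snd_def cd_carrier_def)

lemma cd_e0_in_carrier [simp]: "cd_e 0 \<in> cd_carrier n"
  by (auto simp: cd_carrier_def cd_e_def)

lemma cd_fst_e0 [simp]: "cd_fst n (cd_e 0) = cd_e 0"
  by (auto simp: cd_fst_def cd_e_def)

lemma cd_fst_at_0 [simp]: "cd_fst n u 0 = u 0"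
  by (simp add: cd_fst_def)

lemma cd_snd_e0 [simp]: "cd_snd n (cd_e 0) = 0"
  by (auto simp: cd_snd_def cd_e_def fun_eq_iff)

lemma cd_pair_e0: "cd_pair n (cd_e 0) 0 = cd_e 0"
  by (auto simp: cd_pair_def cd_e_def fun_eq_iff)

text \<open>This trades the recursive conjugation for a linear combination of \<open>cd_e 0\<close>
  and \<open>u\<close>, so that products with conjugates reduce to bilinearity and the unit
  laws.\<close>

lemma cd_conj_eq: "u \<in> cd_carrier n \<Longrightarrow> cd_conj n u = (2 * u 0) *\<^sub>R cd_e 0 - u"
proof (induction n arbitrary: u)
  case 0
  then show ?case
    by (auto simp: cd_carrier_def cd_e_def cd_fun_simps)
next
  case (Suc n)
  have "(2 * u 0) *\<^sub>R cd_e 0 - u =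
      (2 * u 0) *\<^sub>R cd_pair n (cd_e 0) 0 - cd_pair n (cd_fst n u) (cd_snd n u)"
    using Suc.prems by (simp add: cd_pair_e0 cd_pair_fst_snd)
  also have "\<dots> = cd_conj (Suc n) u"
    unfolding cd_conj.simps Suc.IH[OF cd_fst_in_carrier] cd_pair_scaleR cd_pair_diff by simp
  finally show ?case ..
qed

lemma cd_conj_e0 [simp]: "cd_conj n (cd_e 0) = cd_e 0"
  unfolding cd_conj_eq[OF cd_e0_in_carrier] by (simp add: cd_e_def cd_fun_simps)

lemma cd_conj_zero [simp]: "cd_conj n 0 = 0"
  using cd_conj_linear(2)[of n 0 0] by simp

lemma cd_mult_e0:
  assumes "u \<in> cd_carrier n"
  shows "cd_mult n (cd_e 0) u = u" "cd_mult n u (cd_e 0) = u"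
proof -
  \<comment> \<open>The laws are proved jointly: \<open>(e0, 0) (x, y)\<close> has second component
    \<open>y e0\<close>, so the left law at the next level uses the right law.\<close>
  have "cd_mult n (cd_e 0) u = u \<and> cd_mult n u (cd_e 0) = u"
    using assms
  proof (induction n arbitrary: u)
    case 0
    then show ?case
      by (auto simp: cd_carrier_def cd_e_def cd_fun_simps)
  next
    case (Suc n)
    then show ?case
      by (simp add: Let_def cd_pair_fst_snd)
  qed
  then show "cd_mult n (cd_e 0) u = u" "cd_mult n u (cd_e 0) = u"
    by auto
qed

lemma sum_squares_fst_snd:
  "(\<Sum>i<2 ^ Suc n. (u i)\<^sup>2) = (\<Sum>i<2 ^ n. (cd_fst n u i)\<^sup>2) + (\<Sum>i<2 ^ n. (cd_snd n u i)\<^sup>2)"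
proof -
  \<comment> \<open>The length of the upper block is generalized to \<open>m\<close>, so that
    induction can run with the split point \<open>2 ^ n\<close> fixed.\<close>
  have "(\<Sum>i<2 ^ n + m. (u i)\<^sup>2) = (\<Sum>i<2 ^ n. (u i)\<^sup>2) + (\<Sum>i<m. (u (2 ^ n + i))\<^sup>2)" for m
    by (induction m) auto
  from this[of "2 ^ n"] show ?thesis
    by (simp add: cd_fst_def cd_snd_def mult_2)
qed

lemma cd_mult_self:
  "u \<in> cd_carrier n \<Longrightarrow> cd_mult n u u = (2 * u 0) *\<^sub>R u - (\<Sum>i<2 ^ n. (u i)\<^sup>2) *\<^sub>R cd_e 0"
proof (induction n arbitrary: u)
  case 0
  then show ?case
    by (auto simp: cd_carrier_def cd_e_def cd_fun_simps power2_eq_square)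
next
  case (Suc n)
  define a b where ab: "a = cd_fst n u" "b = cd_snd n u"
  define A B where AB: "A = (\<Sum>i<2 ^ n. (a i)\<^sup>2)" "B = (\<Sum>i<2 ^ n. (b i)\<^sup>2)"
  have car: "a \<in> cd_carrier n" "b \<in> cd_carrier n"
    by (simp_all add: ab)
  have a0: "a 0 = u 0"
    by (simp add: ab)
  \<comment> \<open>The induction hypothesis serves for \<open>b\<close> as well: conj(b) b = 2 b_0
    b - b b = |b|^2 e_0.\<close>
  have fst: "cd_mult n a a - cd_mult n (cd_conj n b) b = (2 * u 0) *\<^sub>R a - (A + B) *\<^sub>R cd_e 0"
    unfolding cd_conj_eq[OF car(2)] cd_mult_diff_left cd_mult_scaleR
      cd_mult_e0(1)[OF car(2)] Suc.IH[OF car(1)] Suc.IH[OF car(2)] AB a0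
    by (simp add: scaleR_add_left)
  \<comment> \<open>Here a + conj(a) = 2 a_0 e_0, multiplied from the left by b after b a and b
    conj(a) are expanded.\<close>
  have snd: "cd_mult n b a + cd_mult n b (cd_conj n a) = (2 * u 0) *\<^sub>R b"
    using car a0
    by (simp add: cd_conj_eq cd_mult_diff_right cd_mult_scaleR cd_mult_e0)
  have "cd_mult (Suc n) u u = cd_pair n ((2 * u 0) *\<^sub>R a - (A + B) *\<^sub>R cd_e 0) ((2 * u 0) *\<^sub>R b)"
    by (simp add: Let_def fst snd flip: ab)
  also have "\<dots> = (2 * u 0) *\<^sub>R cd_pair n a b - (A + B) *\<^sub>R cd_pair n (cd_e 0) 0"
    by (simp add: cd_pair_scaleR cd_pair_diff)
  also have "\<dots> = (2 * u 0) *\<^sub>R u - (\<Sum>i<2 ^ Suc n. (u i)\<^sup>2) *\<^sub>R cd_e 0"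
    using Suc.prems unfolding sum_squares_fst_snd by (simp add: ab AB cd_pair_fst_snd cd_pair_e0)
  finally show ?case .
qed

section \<open>Imaginary elements in coordinates\<close>

lemma subspace_cd_carrier: "subspace (cd_carrier n)"
  by (auto simp: subspace_def cd_carrier_def cd_fun_simps)

lemma cd_Im_eq: "cd_Im n = {a \<in> cd_carrier n. a 0 = 0}"
proof (intro equalityI subsetI)
  have sub: "subspace {a \<in> cd_carrier n. a 0 = 0}"
    by (auto simp: subspace_def cd_carrier_def cd_fun_simps)
  show "a \<in> {a \<in> cd_carrier n. a 0 = 0}" if "a \<in> cd_Im n" for a
  proof -
    have "cd_e ` {1..<2 ^ n} \<subseteq> {a \<in> cd_carrier n. a 0 = 0}"
      by (auto simp: cd_carrier_def cd_e_def)
    then show ?thesis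
      using that span_minimal sub unfolding cd_Im_def by blast
  qed
next
  fix a assume a: "a \<in> {a \<in> cd_carrier n. a 0 = 0}"
  have "a j = (\<Sum>i\<in>{1..<2 ^ n}. a i *\<^sub>R cd_e i) j" for j
  proof -
    have "(\<Sum>i\<in>I. a i *\<^sub>R cd_e i) j = (\<Sum>i\<in>I. if j = i then a i else 0)" if "finite I" for I
      using that by (induction I rule: finite_induct) (auto simp: cd_fun_simps cd_e_def)
    \<comment> \<open>Indices outside the sum are harmless: \<open>a\<close> vanishes at 0 by
      assumption, and from \<open>2 ^ n\<close> on by membership in the carrier.\<close>
    then show ?thesis
      using a by (cases "j = 0") (auto simp: cd_carrier_def)
  qed
  then have "a = (\<Sum>i\<in>{1..<2 ^ n}. a i *\<^sub>R cd_e i)" ..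
  also have "\<dots> \<in> cd_Im n"
    unfolding cd_Im_def by (intro span_sum span_scale span_base) auto
  finally show "a \<in> cd_Im n" .
qed

lemma cd_carrier_decompose:
  assumes "x \<in> cd_carrier n"
  obtains r a where "a \<in> cd_Im n" "x = r *\<^sub>R cd_e 0 + a"
proof
  show "x - x 0 *\<^sub>R cd_e 0 \<in> cd_Im n"
    using assms subspace_diff[OF subspace_cd_carrier] subspace_scale[OF subspace_cd_carrier]
    by (simp add: cd_Im_eq) (simp add: cd_e_def cd_fun_simps)
  show "x = x 0 *\<^sub>R cd_e 0 + (x - x 0 *\<^sub>R cd_e 0)"
    by simp
qed

lemma cd_mult_self_Im:
  assumes "a \<in> cd_Im n"
  shows "cd_mult n a a = - ((cd_norm n a)\<^sup>2 *\<^sub>R cd_e 0)"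
  using assms by (simp add: cd_Im_eq cd_mult_self cd_norm_def L2_set_def sum_nonneg)

text \<open>If \<open>a = 0\<close>, the junk value of \<open>Im w / 0\<close> is harmless because it is multiplied by \<open>a\<close>.\<close>

definition cd_of_complex :: "nat \<Rightarrow> (nat \<Rightarrow> real) \<Rightarrow> complex \<Rightarrow> nat \<Rightarrow> real"
  where "cd_of_complex n a w = Re w *\<^sub>R cd_e 0 + (Im w / cd_norm n a) *\<^sub>R a"

lemma cd_of_complex_scaleR: "cd_of_complex n a (c *\<^sub>R w) = c *\<^sub>R cd_of_complex n a w"
  by (simp add: cd_of_complex_def scaleR_add_right)

lemma cd_of_complex_in_carrier: "a \<in> cd_carrier n \<Longrightarrow> cd_of_complex n a w \<in> cd_carrier n"
  unfolding cd_of_complex_def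
  using subspace_cd_carrier by (intro subspace_add subspace_scale) auto

lemma cd_norm_eq_0_iff: "a \<in> cd_carrier n \<Longrightarrow> cd_norm n a = 0 \<longleftrightarrow> a = 0"
  by (auto simp: cd_norm_def L2_set_eq_0_iff cd_carrier_def fun_eq_iff not_less)
    (meson lessThan_iff not_less)

text \<open>For a nonzero, a / |a| squares to -e_0 and so behaves like the imaginary unit. Right
  multiplication by r e_0 + a is the one product that the recursion for powers performs.\<close>

lemma cd_of_complex_mult:
  assumes "a \<in> cd_Im n"
  shows "cd_mult n (cd_of_complex n a w) (r *\<^sub>R cd_e 0 + a) =
    cd_of_complex n a (w * Complex r (cd_norm n a))"
proof (cases "a = 0")
  case True
  then show ?thesis
    \<comment> \<open>The complex factor is now the real number r, and only the real part of
      \<open>w\<close> survives on both sides.\<close>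
    by (simp add: cd_of_complex_def cd_mult_scaleR cd_mult_e0 cd_norm_def L2_set_def mult.commute)
next
  case False
  have car: "a \<in> cd_carrier n"
    using assms by (simp add: cd_Im_eq)
  define t where "t = cd_norm n a"
  have t: "t \<noteq> 0"
    using False car by (simp add: t_def cd_norm_eq_0_iff)
  have "cd_mult n (cd_of_complex n a w) (r *\<^sub>R cd_e 0 + a) =
      (r * Re w) *\<^sub>R cd_e 0 + Re w *\<^sub>R a + (r * (Im w / t)) *\<^sub>R a - (Im w / t * t\<^sup>2) *\<^sub>R cd_e 0"
    using car assms
    by (simp add: cd_of_complex_def cd_mult_add cd_mult_scaleR cd_mult_e0 cd_mult_self_Im
        scaleR_add_right flip: t_def)
  also have "\<dots> = (r * Re w - Im w / t * t\<^sup>2) *\<^sub>R cd_e 0 + (Re w + r * (Im w / t)) *\<^sub>R a"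
    by (simp add: scaleR_diff_left scaleR_add_left)
  also have "\<dots> = cd_of_complex n a (w * Complex r t)"
  proof -
    have "Im w / t * t\<^sup>2 = Im w * t" "Re w + r * (Im w / t) = (Re w * t + Im w * r) / t"
      using t by (simp_all add: power2_eq_square field_simps)
    then show ?thesis
      by (simp add: cd_of_complex_def mult.commute[of r] flip: t_def)
  qed
  finally show ?thesis
    by (simp add: t_def)
qed

lemma cd_power_eq:
  assumes "a \<in> cd_Im n"
  shows "cd_power n (r *\<^sub>R cd_e 0 + a) m = cd_of_complex n a (Complex r (cd_norm n a) ^ m)"
proof (induction m)
  case 0
  then show ?case
    by (simp add: cd_of_complex_def)
next
  case (Suc m)
  show ?case
    unfolding cd_power.simps Suc.IH cd_of_complex_mult[OF assms] by (simp add: mult.commute)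
qed

section \<open>Transfer of the complex exponential series\<close>

text \<open>For fixed \<open>a\<close>, \<open>cd_of_complex n a\<close> is real-linear, hence
  commutes with partial sums; its coordinates are continuous, which gives convergence in
  norm.\<close>

lemma cd_sums_of_complex:
  assumes "a \<in> cd_carrier n" "f sums w"
  shows "cd_sums n (\<lambda>m. cd_of_complex n a (f m)) (cd_of_complex n a w)"
proof -
  have apply_eq: "cd_of_complex n a z i = Re z * cd_e 0 i + Im z / cd_norm n a * a i" for z i
    by (simp add: cd_of_complex_def cd_fun_simps)
  have "(\<Sum>m<N. cd_of_complex n a (f m)) = cd_of_complex n a (\<Sum>m<N. f m)" for N
    by (induction N) (simp_all add: cd_of_complex_def algebra_simps add_divide_distrib)
  \<comment> \<open>The limit is written as an unsimplified difference, the form that the limit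
    rules produce; its norm is then simplified to 0.\<close>
  moreover have "(\<lambda>N. cd_norm n (cd_of_complex n a (\<Sum>m<N. f m) - cd_of_complex n a w))
      \<longlonglongrightarrow> L2_set (\<lambda>i. cd_of_complex n a w i - cd_of_complex n a w i) {..<2 ^ n}"
    unfolding cd_norm_def L2_set_def fun_diff_def apply_eq divide_inverse
    using assms(2) unfolding sums_def by (intro tendsto_intros)
  ultimately show ?thesis
    using assms(1) by (simp add: cd_sums_def cd_of_complex_in_carrier L2_set_def)
qed

lemma cd_sums_exp_term:
  assumes "a \<in> cd_Im n"
  shows "cd_sums n (cd_exp_term n (r *\<^sub>R cd_e 0 + a))
    (exp r *\<^sub>R cd_of_complex n a (cis (cd_norm n a)))"
proof -
  \<comment> \<open>This is the polar form of exp(r + i |a|); linearity later carries the real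
    factor \<open>exp r\<close> out of \<open>cd_of_complex\<close>.\<close>
  have "(\<lambda>m. Complex r (cd_norm n a) ^ m /\<^sub>R fact m) sums (exp r *\<^sub>R cis (cd_norm n a))"
    using exp_converges[of "Complex r (cd_norm n a)"]
    by (simp add: exp_eq_polar scaleR_conv_of_real)
  then have "cd_sums n (\<lambda>m. cd_of_complex n a (Complex r (cd_norm n a) ^ m /\<^sub>R fact m))
      (cd_of_complex n a (exp r *\<^sub>R cis (cd_norm n a)))"
    using assms by (intro cd_sums_of_complex) (simp_all add: cd_Im_eq)
  moreover have "(\<lambda>m. cd_of_complex n a (Complex r (cd_norm n a) ^ m /\<^sub>R fact m)) =
      cd_exp_term n (r *\<^sub>R cd_e 0 + a)"
    by (intro ext) (simp only: cd_exp_term_def cd_power_eq[OF assms] cd_of_complex_scaleR)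
  ultimately show ?thesis
    by (simp only: cd_of_complex_scaleR)
qed

lemma cd_exp_eq:
  assumes "a \<in> cd_Im n"
  shows "cd_exp n (r *\<^sub>R cd_e 0 + a) = exp r *\<^sub>R cd_of_complex n a (cis (cd_norm n a))"
  using cd_sums_exp_term[OF assms] cd_sums_suminf cd_sums_unique
  unfolding cd_exp_def cd_summable_def by blast

theorem theorem1p3:
  fixes n :: nat
  assumes "n \<ge> 1"
  shows "(\<forall>x \<in> cd_carrier n. cd_summable n (cd_exp_term n x)) \<and>
    (\<forall>x \<in> cd_carrier n. \<forall>r :: real. \<forall>a \<in> cd_Im n.
       x = r *\<^sub>R cd_e 0 + a \<longrightarrow> cd_exp n x = exp r *\<^sub>R cd_exp n a)"
proof (intro conjI ballI allI impI)
  fix x assume "x \<in> cd_carrier n"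
  then obtain r a where "a \<in> cd_Im n" "x = r *\<^sub>R cd_e 0 + a"
    by (rule cd_carrier_decompose)
  then show "cd_summable n (cd_exp_term n x)"
    unfolding cd_summable_def using cd_sums_exp_term by blast
next
  fix x r a assume a: "a \<in> cd_Im n" and x: "x = r *\<^sub>R cd_e 0 + a"
  show "cd_exp n x = exp r *\<^sub>R cd_exp n a"
    \<comment> \<open>The instance with real part 0 evaluates exp(a), since
      \<open>exp 0 = 1\<close>; both formulas share the same \<open>cis\<close> term.\<close>
    using cd_exp_eq[OF a, of r] cd_exp_eq[OF a, of 0] by (simp add: x)
qed

end
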